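(* Let $\mathbf P=(P,\leq)$ be a poset, $a,b\in P$ with $a\leq b$, $x\in[a,b]$ and $y\in P$, and assume that $e$ is the greatest element of $L\big(U(a,y),b\big)$ and $f$ is the smallest element of $U\big(a,L(y,b)\big)$. Then $a\leq f\leq e\leq b$, and the following are equivalent: (i) $e,f\in R(a,b,x)$; (ii) $L\big(U(a,y),x\big)=L(a)$ and $U\big(x,L(y,b)\big)=U(b)$.
   Context: In a poset $(P,\leq)$, for $A\subseteq P$ let $L(A)=\{p\in P\mid p\leq a\text{ for all }a\in A\}$ and $U(A)=\{p\in P\mid a\leq p\text{ for all }a\in A\}$. One writes $L(a)$ for $L(\{a\})$, $L(a,b)$ for $L(\{a,b\})$, $L(A,a)$ for $L(A\cup\{a\})$, and similarly for $U$; e.g. $L\big(U(a,y),b\big)=L\big(U(\{a,y\})\cup\{b\}\big)$ and $U\big(a,L(y,b)\big)=U\big(\{a\}\cup L(\{y,b\})\big)$. For $a\leq b$ and $x\in[a,b]$, an element $z\in[a,b]$ is a relative complement of $x$ in $[a,b]$ if $U(x,z)=U(b)$ and $L(x,z)=L(a)$; $R(a,b,x)$ denotes the set of all such relative complements. *)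

theory Defs
  imports "HOL-Algebra.Order"
begin

text \<open>
  The cones $U(x,z)$, $L(x,z)$ are formed in the whole poset, not in the interval $[a,b]$.
  The conditions $a \le b$ and $x \in [a,b]$ are not part of the definition; they are left to
  the places where it is used.
\<close>

definition rel_complements :: "('a, 'c) gorder_scheme \<Rightarrow> 'a \<Rightarrow> 'a \<Rightarrow> 'a \<Rightarrow> 'a set" where
  "rel_complements P a b x =
     {z \<in> \<lbrace>a..b\<rbrace>\<^bsub>P\<^esub>. Upper P {x, z} = Upper P {b} \<and> Lower P {x, z} = Lower P {a}}"

end

theory Submission
  imports Defs
begin

text \<open>
  Since $x \le b$ and $a \le x$, the cones of (ii) are $L(x,e)$ and $U(x,f)$. The remaining
  equalities of (i) follow by monotonicity from $a \le f \le e \le b$.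
\<close>

context weak_partial_order
begin

text \<open>Transitivity makes the cone closed downwards, so it is the principal ideal of
  \<open>e\<close>; this trades a cone condition for a single comparison.\<close>

lemma Lower_greatest:
  assumes "greatest L e (Lower L A)" and "p \<in> carrier L"
  shows "p \<sqsubseteq> e \<longleftrightarrow> p \<in> Lower L A"
proof
  assume "p \<sqsubseteq> e"
  moreover have "e \<in> Lower L A" using assms(1) by (simp add: greatest_def)
  ultimately show "p \<in> Lower L A"
    using assms(2) greatest_closed[OF assms(1)] le_trans[of p e]
    unfolding Lower_def by blast
qed (use assms(1) in \<open>simp add: greatest_def\<close>)

lemma Upper_least:
  assumes "least L f (Upper L A)" and "p \<in> carrier L"
  shows "f \<sqsubseteq> p \<longleftrightarrow> p \<in> Upper L A"
proof
  assume "f \<sqsubseteq> p"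
  moreover have "f \<in> Upper L A" using assms(1) by (simp add: least_def)
  ultimately show "p \<in> Upper L A"
    using assms(2) least_closed[OF assms(1)] le_trans[of _ f p]
    unfolding Upper_def by blast
qed (use assms(1) in \<open>simp add: least_def\<close>)

end

theorem theorem4:
  fixes P :: "('a, 'c) gorder_scheme" (structure)
    and a b x y e f :: 'a
  assumes "partial_order P"
    and "a \<in> carrier P" and "b \<in> carrier P" and "a \<sqsubseteq> b"
    and "x \<in> \<lbrace>a..b\<rbrace>" and "y \<in> carrier P"
    and "greatest P e (Lower P (Upper P {a, y} \<union> {b}))"
    and "least P f (Upper P ({a} \<union> Lower P {y, b}))"
  shows "(a \<sqsubseteq> f \<and> f \<sqsubseteq> e \<and> e \<sqsubseteq> b) \<and>
    ((e \<in> rel_complements P a b x \<and> f \<in> rel_complements P a b x) \<longleftrightarrow>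
     (Lower P (Upper P {a, y} \<union> {x}) = Lower P {a} \<and>
      Upper P ({x} \<union> Lower P {y, b}) = Upper P {b}))"
proof -
  interpret partial_order P by fact
  have x: "x \<in> carrier P" "a \<sqsubseteq> x" "x \<sqsubseteq> b"
    using assms(5) by (auto simp: at_least_at_most_def)
  have eL: "e \<in> Lower P (Upper P {a, y} \<union> {b})"
    using assms(7) by (simp add: greatest_def)
  have fU: "f \<in> Upper P ({a} \<union> Lower P {y, b})"
    using assms(8) by (simp add: least_def)
  have e: "e \<in> carrier P" "e \<sqsubseteq> b" using eL assms(3) by (auto simp: Lower_def)
  have f: "f \<in> carrier P" "a \<sqsubseteq> f" using fU assms(2) by (auto simp: Upper_def)
  note le_e = Lower_greatest[OF assms(7)] and f_le = Upper_least[OF assms(8)]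
  have "a \<in> Lower P (Upper P {a, y} \<union> {b})"
    using assms(2,4) by (auto simp: Lower_def Upper_def)
  then have ae: "a \<sqsubseteq> e" using le_e assms(2) by simp
  \<comment> \<open>Such a \<open>p\<close> is below \<open>y\<close>, hence below every upper bound
    of \<open>a\<close> and \<open>y\<close>.\<close>
  have "p \<sqsubseteq> e" if "p \<in> Lower P {y, b}" for p
  proof -
    have p: "p \<in> carrier P" "p \<sqsubseteq> y" "p \<sqsubseteq> b"
      using that assms(3,6) by (auto simp: Lower_def)
    have "p \<in> Lower P (Upper P {a, y} \<union> {b})"
      using p assms(6) le_trans[of p y] by (auto simp: Lower_def Upper_def)
    then show ?thesis using le_e p by simp
  qed
  then have "e \<in> Upper P ({a} \<union> Lower P {y, b})"
    using ae e by (auto simp: Upper_def)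
  then have fe: "f \<sqsubseteq> e" using f_le e by simp
  have fb: "f \<sqsubseteq> b" using le_trans[OF fe e(2) f(1) e(1) assms(3)] .
  have Lxe: "Lower P {x, e} = Lower P (Upper P {a, y} \<union> {x})"
  proof -
    \<comment> \<open>Cones are subsets of the carrier, so comparing carrier points
      suffices.\<close>
    have "p \<in> Lower P {x, e} \<longleftrightarrow> p \<in> Lower P (Upper P {a, y} \<union> {x})"
      if p: "p \<in> carrier P" for p
    proof -
      have "p \<in> Lower P {x, e} \<longleftrightarrow> p \<sqsubseteq> x \<and> p \<sqsubseteq> e"
        using p x e by (auto simp: Lower_def)
      also have "\<dots> \<longleftrightarrow> p \<sqsubseteq> x \<and> p \<in> Lower P (Upper P {a, y} \<union> {b})"
        using le_e[OF p] by simp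
      \<comment> \<open>Here \<open>b\<close> drops out: below \<open>x\<close> implies below
        \<open>b\<close>.\<close>
      also have "\<dots> \<longleftrightarrow> p \<in> Lower P (Upper P {a, y} \<union> {x})"
        using p x assms(3) le_trans[of p x b] by (auto simp: Lower_def)
      finally show ?thesis .
    qed
    then show ?thesis by (meson Lower_closed subsetD subset_antisym subsetI)
  qed
  have Uxf: "Upper P {x, f} = Upper P ({x} \<union> Lower P {y, b})"
  proof -
    have "p \<in> Upper P {x, f} \<longleftrightarrow> p \<in> Upper P ({x} \<union> Lower P {y, b})"
      if p: "p \<in> carrier P" for p
    proof -
      have "p \<in> Upper P {x, f} \<longleftrightarrow> x \<sqsubseteq> p \<and> f \<sqsubseteq> p"
        using p x f by (auto simp: Upper_def)
      also have "\<dots> \<longleftrightarrow> x \<sqsubseteq> p \<and> p \<in> Upper P ({a} \<union> Lower P {y, b})"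
        using f_le[OF p] by simp
      \<comment> \<open>Dually \<open>a\<close> drops out, since above \<open>x\<close> implies
        above \<open>a\<close>.\<close>
      also have "\<dots> \<longleftrightarrow> p \<in> Upper P ({x} \<union> Lower P {y, b})"
        using p x assms(2) le_trans[of a x p] by (auto simp: Upper_def)
      finally show ?thesis .
    qed
    then show ?thesis by (meson Upper_closed subsetD subset_antisym subsetI)
  qed
  \<comment> \<open>Passing from \<open>f\<close> up to \<open>e\<close> shrinks the upper cone, but
    it still contains $U(b)$ because \<open>x\<close> and \<open>e\<close> are below
    \<open>b\<close>.\<close>
  have Uxe: "Upper P {x, e} = Upper P {b}" if "Upper P {x, f} = Upper P {b}"
  proof
    have "Upper P {x, e} \<subseteq> Upper P {x, f}"
      using fe e(1) f(1) le_trans[of f e] by (auto simp: Upper_def)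
    then show "Upper P {x, e} \<subseteq> Upper P {b}" using that by simp
    show "Upper P {b} \<subseteq> Upper P {x, e}"
      using x e assms(3) le_trans[of x b] le_trans[of e b] by (auto simp: Upper_def)
  qed
  have Lxf: "Lower P {x, f} = Lower P {a}" if "Lower P {x, e} = Lower P {a}"
  proof
    have "Lower P {x, f} \<subseteq> Lower P {x, e}"
      using fe e(1) f(1) le_trans[of _ f e] by (auto simp: Lower_def)
    then show "Lower P {x, f} \<subseteq> Lower P {a}" using that by simp
    show "Lower P {a} \<subseteq> Lower P {x, f}"
      using x f assms(2) le_trans[of _ a x] le_trans[of _ a f] by (auto simp: Lower_def)
  qed
  have "e \<in> \<lbrace>a..b\<rbrace>" "f \<in> \<lbrace>a..b\<rbrace>"
    using e f ae fb by (auto simp: at_least_at_most_def)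
  \<comment> \<open>Read backwards, \<open>Lxe\<close> and \<open>Uxf\<close> turn (ii) into the
    equations for $L(x,e)$ and $U(x,f)$; \<open>Uxe\<close> and \<open>Lxf\<close> supply the
    remaining two.\<close>
  then show ?thesis
    using f(2) fe e(2) Uxe Lxf unfolding rel_complements_def Lxe[symmetric] Uxf[symmetric]
    by auto
qed

end
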